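(* Let $d\ge 3$, $k\ge 2$, $j\ge 1$ be integers and let $\{\Omega_n\}_{n\in\mathbb N}$ be a sequence of finite connected $d$-regular graphs which is an expander, is dg-bounded, and has large girth. Let $\Omega=\bigsqcup_n\Omega_n$, and let $\{\Gamma_\alpha\}_{\alpha\in\mathcal A(\Omega,T^j)}$ be the associated random monster group. Let $1\to N\xrightarrow{i}G\xrightarrow{q}G/N\to 1$ be a short exact sequence of countable discrete groups. If $\Gamma_\alpha$ has hereditary super-rigidity with respect to $N$ and super-rigidity with respect to $G/N$, then $\Gamma_\alpha$ has super-rigidity with respect to $G$.
   Context: Graphs. For a finite connected graph $\Omega$, $|\Omega|$ is the number of vertices and the Cheeger constant is $h(\Omega)=\min_{1\le |A|\le |\Omega|/2}|\partial A|/|A|$, where $A$ ranges over sets of vertices and $\partial A$ is the set of edges between $A$ and its complement. A sequence $\{\Omega_n\}$ of finite connected graphs of uniformly bounded degree is an expander if $|\Omega_n|\to\infty$ and there is $c>0$ with $h(\Omega_n)\ge c$ for all $n$. The girth of a graph is the edge-length of its shortest non-trivial cycle; the diameter is the greatest edge-length distance between two vertices. The sequence has large girth if $\mathrm{girth}(\Omega_n)\to\infty$, and is dg-bounded if there is $D>0$ with $\mathrm{diam}(\Omega_n)\le D\,\mathrm{girth}(\Omega_n)$ for all $n$. Random monster group. $F_k$ is the free group of rank $k$ with symmetric generating set $T$ of size $2k$ (a free basis and its inverses), and $T^j\subset F_k$ is the set of elements of the form $t_1\cdots t_j$ with $t_i\in T$. A symmetric $F_k$-labelling of a graph is a map $\alpha$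 from its oriented edges to $F_k$ with $\alpha(e^{-1})=\alpha(e)^{-1}$ for every edge $e$. $\mathcal A(\Omega,T^j)$ is the set of symmetric $F_k$-labellings of $\Omega$ with values in $T^j$; for $\Omega=\bigsqcup_n\Omega_n$ it is given the product of the uniform probability distributions on the finite sets $\mathcal A(\Omega_n,T^j)$, and "almost every" refers to this probability. For $\alpha\in\mathcal A(\Omega,T^j)$, $\Gamma_\alpha$ is the quotient of $F_k$ by the normal closure of all elements $\alpha(e_1)\cdots\alpha(e_m)$, where $e_1\cdots e_m$ is a closed path in $\Omega$. Super-rigidity. Let $H$ be a countable discrete group. $\Gamma_\alpha$ has super-rigidity with respect to $H$ if for almost every $\alpha\in\mathcal A(\Omega,T^j)$ every group homomorphism $\Gamma_\alpha\to H$ has finite image. $\Gamma_\alpha$ has hereditary super-rigidity with respect to $H$ if for almost every $\alpha\in\mathcal A(\Omega,T^j)$ every group homomorphism from a finite index subgroup of $\Gamma_\alpha$ to $H$ has finite image. *)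

theory Defs
  imports
    "HOL-Algebra.Coset"
    "HOL-Probability.Infinite_Product_Measure"
    "Graph_Theory.Graph_Theory"
    "Graph_Theory.Shortest_Path"
begin

section \<open>Graphs\<close>

text \<open>
  Graphs are taken in the sense of Serre: \<open>arcs G\<close> is the set of oriented edges, and \<open>arev\<close> is the
  orientation reversal \<open>e \<mapsto> e\<inverse>\<close>, a fixed-point free involution of \<open>arcs G\<close>.  Loops and multiple
  edges are allowed; simple graphs are a special case.
\<close>

definition finite_connected_graph :: "('v, 'e) pre_digraph \<Rightarrow> ('e \<Rightarrow> 'e) \<Rightarrow> bool" where
  "finite_connected_graph G arev \<longleftrightarrow>
     fin_digraph G \<and> bidirected_digraph G arev \<and> Digraph_Component.connected G"

definition regular :: "nat \<Rightarrow> ('v, 'e) pre_digraph \<Rightarrow> bool" where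
  "regular d G \<longleftrightarrow> (\<forall>v \<in> verts G. out_degree G v = d)"

text \<open>
  An unoriented edge between \<open>A\<close> and its complement is represented by the one of its two orientations
  which leaves \<open>A\<close>.
\<close>

definition edge_boundary :: "('v, 'e) pre_digraph \<Rightarrow> 'v set \<Rightarrow> 'e set" where
  "edge_boundary G A = {e \<in> arcs G. tail G e \<in> A \<and> head G e \<notin> A}"

text \<open>
  The infimum is a minimum as soon as \<open>G\<close> is finite with at least two vertices; for a single
  vertex it is \<open>\<infinity>\<close>.
\<close>

definition cheeger :: "('v, 'e) pre_digraph \<Rightarrow> ereal" where
  "cheeger G = (INF A \<in> {A. A \<subseteq> verts G \<and> 1 \<le> card A \<and> 2 * card A \<le> card (verts G)}.
     ereal (real (card (edge_boundary G A)) / real (card A)))"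

definition expander :: "(nat \<Rightarrow> ('v, 'e) pre_digraph) \<Rightarrow> bool" where
  "expander \<Omega> \<longleftrightarrow>
     (\<exists>B. \<forall>n. \<forall>v \<in> verts (\<Omega> n). out_degree (\<Omega> n) v \<le> B) \<and>
     filterlim (\<lambda>n. card (verts (\<Omega> n))) at_top sequentially \<and>
     (\<exists>c::real. c > 0 \<and> (\<forall>n. ereal c \<le> cheeger (\<Omega> n)))"

text \<open>
  The closed walk \<open>[e, arev e]\<close> is a directed cycle; the second condition excludes it.  It
  excludes nothing else: loops and pairs of parallel edges are non-trivial cycles.
\<close>

definition nontrivial_cycle :: "('v, 'e) pre_digraph \<Rightarrow> ('e \<Rightarrow> 'e) \<Rightarrow> 'e list \<Rightarrow> bool" where
  "nontrivial_cycle G arev p \<longleftrightarrow> pre_digraph.cycle G p \<and> (\<forall>e \<in> set p. arev e \<notin> set p)"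

definition girth :: "('v, 'e) pre_digraph \<Rightarrow> ('e \<Rightarrow> 'e) \<Rightarrow> ereal" where
  "girth G arev = (INF p \<in> {p. nontrivial_cycle G arev p}. ereal (real (length p)))"

definition diam :: "('v, 'e) pre_digraph \<Rightarrow> ereal" where
  "diam G = (SUP u \<in> verts G. SUP v \<in> verts G. wf_digraph.\<mu> G (\<lambda>_. 1) u v)"

definition large_girth ::
    "(nat \<Rightarrow> ('v, 'e) pre_digraph) \<Rightarrow> (nat \<Rightarrow> 'e \<Rightarrow> 'e) \<Rightarrow> bool" where
  "large_girth \<Omega> arev \<longleftrightarrow> (\<lambda>n. girth (\<Omega> n) (arev n)) \<longlonglongrightarrow> \<infinity>"

definition dg_bounded ::
    "(nat \<Rightarrow> ('v, 'e) pre_digraph) \<Rightarrow> (nat \<Rightarrow> 'e \<Rightarrow> 'e) \<Rightarrow> bool" where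
  "dg_bounded \<Omega> arev \<longleftrightarrow>
     (\<exists>D::real. D > 0 \<and> (\<forall>n. diam (\<Omega> n) \<le> ereal D * girth (\<Omega> n) (arev n)))"


section \<open>The free group of rank \<open>k\<close>\<close>

text \<open>
  The letter \<open>(i, True)\<close> is the \<open>i\<close>-th basis element and \<open>(i, False)\<close> its inverse; elements of the
  free group are freely reduced words.
\<close>

type_synonym letter = "nat \<times> bool"

definition letter_inv :: "letter \<Rightarrow> letter" where
  "letter_inv x = (fst x, \<not> snd x)"

definition reduced :: "letter list \<Rightarrow> bool" where
  "reduced = successively (\<lambda>x y. y \<noteq> letter_inv x)"

fun cons_reduce :: "letter \<Rightarrow> letter list \<Rightarrow> letter list" where
  "cons_reduce x [] = [x]"
| "cons_reduce x (y # w) = (if y = letter_inv x then w else x # y # w)"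

definition free_group :: "nat \<Rightarrow> letter list monoid" where
  "free_group k =
     \<lparr>carrier = {w. reduced w \<and> set w \<subseteq> {..<k} \<times> UNIV},
      monoid.mult = (\<lambda>v w. foldr cons_reduce v w),
      one = []\<rparr>"

lemma letter_inv_simps [simp]:
  "letter_inv (letter_inv x) = x" "letter_inv x \<noteq> x" "fst (letter_inv x) = fst x"
  by (auto simp: letter_inv_def prod_eq_iff)

lemma reduced_simps [simp]:
  "reduced []" "reduced [x]"
  "reduced (x # y # w) \<longleftrightarrow> y \<noteq> letter_inv x \<and> reduced (y # w)"
  by (auto simp: reduced_def)

lemma reduced_ConsD: "reduced (x # w) \<Longrightarrow> reduced w"
  by (cases w) auto

lemma reduced_cons_reduce: "reduced w \<Longrightarrow> reduced (cons_reduce x w)"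
  by (cases w) (auto dest: reduced_ConsD)

lemma reduced_foldr: "reduced w \<Longrightarrow> reduced (foldr cons_reduce v w)"
  by (induction v) (auto intro: reduced_cons_reduce)

lemma set_cons_reduce: "set (cons_reduce x w) \<subseteq> insert x (set w)"
  by (cases w) auto

lemma set_foldr_cons_reduce: "set (foldr cons_reduce v w) \<subseteq> set v \<union> set w"
  by (induction v) (use set_cons_reduce in fastforce)+

lemma cons_reduce_cancel:
  assumes "reduced w" shows "cons_reduce x (cons_reduce (letter_inv x) w) = w"
proof (cases w)
  case (Cons y v)
  with assms show ?thesis by (cases v) auto
qed auto

lemma foldr_cons_reduce_id: "reduced w \<Longrightarrow> foldr cons_reduce w [] = w"
proof (induction w)
  case (Cons x w)
  then show ?case by (cases w) (auto dest: reduced_ConsD)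
qed auto

lemma foldr_cons_reduce_cons:
  assumes "reduced w"
  shows "foldr cons_reduce (cons_reduce x v) w = cons_reduce x (foldr cons_reduce v w)"
proof (cases v)
  case (Cons y v')
  with assms show ?thesis
    using cons_reduce_cancel[of "foldr cons_reduce v' w" x] reduced_foldr[of w v'] by auto
qed auto

lemma foldr_cons_reduce_assoc:
  assumes "reduced w"
  shows "foldr cons_reduce (foldr cons_reduce u v) w = foldr cons_reduce u (foldr cons_reduce v w)"
  by (induction u) (auto simp: foldr_cons_reduce_cons assms)

lemma foldr_cons_reduce_inv:
  assumes "reduced w"
  shows "foldr cons_reduce (rev (map letter_inv u)) (foldr cons_reduce u w) = w"
  using assms
proof (induction u arbitrary: w)
  case (Cons x u)
  then show ?case
    using cons_reduce_cancel[of "foldr cons_reduce u w" "letter_inv x"] reduced_foldr[of w u] by auto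
qed auto

lemma group_free_group: "group (free_group k)"
proof (rule groupI)
  fix x assume x: "x \<in> carrier (free_group k)"
  let ?v = "rev (map letter_inv x)"
  let ?y = "foldr cons_reduce ?v []"
  have "foldr cons_reduce ?y x = foldr cons_reduce ?v (foldr cons_reduce x [])"
    using x foldr_cons_reduce_assoc[of x ?v "[]"] foldr_cons_reduce_id[of x]
    by (simp add: free_group_def)
  then have "foldr cons_reduce ?y x = []"
    using foldr_cons_reduce_inv[of "[]" x] by simp
  moreover have "set ?y \<subseteq> {..<k} \<times> UNIV"
    using x set_foldr_cons_reduce[of ?v "[]"] by (fastforce simp: free_group_def letter_inv_def)
  ultimately show "\<exists>y\<in>carrier (free_group k). y \<otimes>\<^bsub>free_group k\<^esub> x = \<one>\<^bsub>free_group k\<^esub>"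
    by (intro bexI[of _ ?y]) (auto simp: free_group_def reduced_foldr)
next
  fix x y assume "x \<in> carrier (free_group k)" "y \<in> carrier (free_group k)"
  then show "x \<otimes>\<^bsub>free_group k\<^esub> y \<in> carrier (free_group k)"
    using set_foldr_cons_reduce[of x y] by (fastforce simp: free_group_def reduced_foldr)
qed (auto simp: free_group_def foldr_cons_reduce_assoc)

definition list_mult :: "('a, 'b) monoid_scheme \<Rightarrow> 'a list \<Rightarrow> 'a" where
  "list_mult G xs = foldr (\<lambda>x y. x \<otimes>\<^bsub>G\<^esub> y) xs \<one>\<^bsub>G\<^esub>"

definition free_gens :: "nat \<Rightarrow> letter list set" where
  "free_gens k = {[x] | x. x \<in> {..<k} \<times> (UNIV :: bool set)}"

definition gens_pow :: "nat \<Rightarrow> nat \<Rightarrow> letter list set" where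
  "gens_pow k j = {list_mult (free_group k) ts | ts. length ts = j \<and> set ts \<subseteq> free_gens k}"

definition normal_closure :: "('a, 'b) monoid_scheme \<Rightarrow> 'a set \<Rightarrow> 'a set" where
  "normal_closure G R = \<Inter> {N. N \<lhd> G \<and> R \<subseteq> N}"


section \<open>Random monster groups\<close>

text \<open>
  Labellings are extensional functions on the oriented edges, so there are only finitely many.
\<close>

definition labellings ::
    "nat \<Rightarrow> ('v, 'e) pre_digraph \<Rightarrow> ('e \<Rightarrow> 'e) \<Rightarrow> letter list set \<Rightarrow> ('e \<Rightarrow> letter list) set" where
  "labellings k G arev S =
     {\<alpha> \<in> arcs G \<rightarrow>\<^sub>E S. \<forall>e \<in> arcs G. \<alpha> (arev e) = inv\<^bsub>free_group k\<^esub> (\<alpha> e)}"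

text \<open>
  A labelling of the disjoint union of the graphs \<open>\<Omega> n\<close> is a family of labellings of the \<open>\<Omega> n\<close>.
\<close>

definition labelling_measure ::
    "nat \<Rightarrow> nat \<Rightarrow> (nat \<Rightarrow> ('v, 'e) pre_digraph) \<Rightarrow> (nat \<Rightarrow> 'e \<Rightarrow> 'e) \<Rightarrow>
     (nat \<Rightarrow> 'e \<Rightarrow> letter list) measure" where
  "labelling_measure k j \<Omega> arev =
     (\<Pi>\<^sub>M n \<in> UNIV. uniform_count_measure (labellings k (\<Omega> n) (arev n) (gens_pow k j)))"

text \<open>
  A closed path in the disjoint union is a closed path in one of the \<open>\<Omega> n\<close>.
\<close>

definition monster_relators ::
    "nat \<Rightarrow> (nat \<Rightarrow> ('v, 'e) pre_digraph) \<Rightarrow> (nat \<Rightarrow> 'e \<Rightarrow> letter list) \<Rightarrow> letter list set" where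
  "monster_relators k \<Omega> \<alpha> =
     {list_mult (free_group k) (map (\<alpha> n) p) | n u p. pre_digraph.awalk (\<Omega> n) u p u}"

definition monster_group ::
    "nat \<Rightarrow> (nat \<Rightarrow> ('v, 'e) pre_digraph) \<Rightarrow> (nat \<Rightarrow> 'e \<Rightarrow> letter list) \<Rightarrow> letter list set monoid" where
  "monster_group k \<Omega> \<alpha> =
     free_group k Mod normal_closure (free_group k) (monster_relators k \<Omega> \<alpha>)"


section \<open>Super-rigidity\<close>

definition super_rigid :: "'x measure \<Rightarrow> ('x \<Rightarrow> 'a monoid) \<Rightarrow> 'b monoid \<Rightarrow> bool" where
  "super_rigid M \<Gamma> H \<longleftrightarrow>
     (AE \<alpha> in M. \<forall>\<phi> \<in> hom (\<Gamma> \<alpha>) H. finite (\<phi> ` carrier (\<Gamma> \<alpha>)))"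

definition hereditarily_super_rigid ::
    "'x measure \<Rightarrow> ('x \<Rightarrow> 'a monoid) \<Rightarrow> 'b monoid \<Rightarrow> bool" where
  "hereditarily_super_rigid M \<Gamma> H \<longleftrightarrow>
     (AE \<alpha> in M. \<forall>K. subgroup K (\<Gamma> \<alpha>) \<and> finite (rcosets\<^bsub>\<Gamma> \<alpha>\<^esub> K) \<longrightarrow>
        (\<forall>\<phi> \<in> hom ((\<Gamma> \<alpha>)\<lparr>carrier := K\<rparr>) H. finite (\<phi> ` K)))"

end

theory Submission
  imports Defs
begin

text \<open>
  Fix \<open>\<alpha>\<close> for which both rigidity properties hold, and write \<open>\<Gamma>\<close> for \<open>\<Gamma>\<^sub>\<alpha>\<close>.
  A homomorphism \<open>\<phi>\<close> from \<open>\<Gamma>\<close> to \<open>G\<close> composed with \<open>q\<close> has finite image by super-rigidity with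
  respect to \<open>G/N\<close>, so its kernel \<open>K\<close> has finite index in \<open>\<Gamma>\<close>.  By exactness \<open>\<phi>\<close> maps \<open>K\<close> into
  \<open>i(N)\<close>, hence restricts to a homomorphism from \<open>K\<close> to \<open>N\<close>, whose image is finite by hereditary
  super-rigidity.  As \<open>\<phi>(\<Gamma>)\<close> is a union of finitely many translates of \<open>\<phi>(K)\<close>, it is finite.
  This argument works for each \<open>\<alpha>\<close> separately and for every group \<open>\<Gamma>\<close>
  (\<open>finite_image_of_extension\<close>), so the two almost sure properties combine into the third.
  It remains to see that \<open>\<Gamma>\<^sub>\<alpha>\<close> is a group for almost every \<open>\<alpha>\<close>.  This holds on the whole sample
  space, since the relators of a labelling lie in the carrier of the free group
  (\<open>group_monster_group\<close>).
\<close>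

lemma (in group_hom) finite_rcosets_kernel:
  assumes "finite (h ` carrier G)"
  shows "finite (rcosets (kernel G H h))"
proof -
  have "(\<lambda>X. the_elem (h ` X)) ` carrier (G Mod kernel G H h) \<subseteq> h ` carrier G"
  proof safe
    fix X assume X: "X \<in> carrier (G Mod kernel G H h)"
    then obtain g where g: "g \<in> carrier G" "X = kernel G H h #> g"
      unfolding FactGroup_def RCOSETS_def by auto
    have "h ` X = {h g}"
    proof
      show "h ` X \<subseteq> {h g}"
        using g by (auto simp: r_coset_def kernel_def)
      have "g \<in> X"
        using g G.rcos_self[OF g(1) subgroup_kernel] by simp
      then show "{h g} \<subseteq> h ` X" by simp
    qed
    with g show "the_elem (h ` X) \<in> h ` carrier G" by simp
  qed
  with assms have "finite ((\<lambda>X. the_elem (h ` X)) ` carrier (G Mod kernel G H h))"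
    by (rule rev_finite_subset)
  then have "finite (carrier (G Mod kernel G H h))"
    using FactGroup_inj_on by (rule finite_imageD)
  then show ?thesis by (simp add: FactGroup_def)
qed

lemma (in group_hom) finite_image_if_finite_index:
  assumes "subgroup K G" and "finite (rcosets K)" and "finite (h ` K)"
  shows "finite (h ` carrier G)"
proof -
  have "finite (h ` X)" if X: "X \<in> rcosets K" for X
  proof -
    obtain g where g: "g \<in> carrier G" "X = K #> g"
      using X by (auto simp: RCOSETS_def)
    have "h ` X = (\<lambda>y. y \<otimes>\<^bsub>H\<^esub> h g) ` h ` K"
    proof -
      have "h (x \<otimes> g) = h x \<otimes>\<^bsub>H\<^esub> h g" if "x \<in> K" for x
        using subgroup.mem_carrier[OF assms(1) that] g(1) by (rule hom_mult)
      then have "(\<lambda>x. h (x \<otimes> g)) ` K = (\<lambda>x. h x \<otimes>\<^bsub>H\<^esub> h g) ` K"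
        by (rule image_cong[OF refl])
      moreover have "X = (\<lambda>x. x \<otimes> g) ` K"
        unfolding g r_coset_def by blast
      ultimately show ?thesis by (simp only: image_image)
    qed
    then show ?thesis using assms(3) by (simp only: finite_imageI)
  qed
  with assms(2) have "finite (\<Union>X \<in> rcosets K. h ` X)"
    by (rule finite_UN_I)
  also have "(\<Union>X \<in> rcosets K. h ` X) = h ` carrier G"
    unfolding G.rcosets_part_G[OF assms(1), symmetric] by (rule image_Union[symmetric])
  finally show ?thesis .
qed

text \<open>
  The deterministic core: the property of having only finite images passes from \<open>Q\<close>, together with
  the corresponding property of all finite index subgroups for \<open>N\<close>, to an extension \<open>G\<close> of \<open>Q\<close>
  by \<open>N\<close>.
\<close>

lemma finite_image_of_extension:
  fixes i :: "'n \<Rightarrow> 'g" and q :: "'g \<Rightarrow> 'q"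
  assumes "group \<Gamma>" "group N" "group G" "group Q"
    and i: "i \<in> mon N G" and q: "q \<in> hom G Q" and exact: "kernel G Q q = i ` carrier N"
    and N: "\<And>K \<psi>. subgroup K \<Gamma> \<Longrightarrow> finite (rcosets\<^bsub>\<Gamma>\<^esub> K) \<Longrightarrow> \<psi> \<in> hom (\<Gamma>\<lparr>carrier := K\<rparr>) N \<Longrightarrow>
      finite (\<psi> ` K)"
    and Q: "\<And>\<psi>. \<psi> \<in> hom \<Gamma> Q \<Longrightarrow> finite (\<psi> ` carrier \<Gamma>)"
    and \<phi>: "\<phi> \<in> hom \<Gamma> G"
  shows "finite (\<phi> ` carrier \<Gamma>)"
proof -
  have comp: "q \<circ> \<phi> \<in> hom \<Gamma> Q"
    using \<phi> q by (rule hom_compose)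
  interpret \<phi>: group_hom \<Gamma> G \<phi>
    using assms by (simp add: group_hom_def group_hom_axioms_def)
  interpret comp: group_hom \<Gamma> Q "q \<circ> \<phi>"
    using assms comp by (simp add: group_hom_def group_hom_axioms_def)
  let ?K = "kernel \<Gamma> Q (q \<circ> \<phi>)"
  \<comment> \<open>By exactness, \<open>\<phi>\<close> restricted to \<open>?K\<close> factors as \<open>i\<close> after a homomorphism into \<open>N\<close>, namely:\<close>
  let ?\<psi> = "inv_into (carrier N) i \<circ> \<phi>"
  have K: "subgroup ?K \<Gamma>" by (rule comp.subgroup_kernel)
  have index: "finite (rcosets\<^bsub>\<Gamma>\<^esub> ?K)"
    using Q[OF comp] by (rule comp.finite_rcosets_kernel)
  have inj: "inj_on i (carrier N)" and i_hom: "i \<in> hom N G"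
    using i by (auto simp: mon_def)
  have lift: "?\<psi> x \<in> carrier N" "i (?\<psi> x) = \<phi> x" if "x \<in> ?K" for x
  proof -
    have "\<phi> x \<in> i ` carrier N"
      using that unfolding exact[symmetric] by (auto simp: kernel_def)
    then show "?\<psi> x \<in> carrier N" "i (?\<psi> x) = \<phi> x"
      by (auto simp: inv_into_into f_inv_into_f)
  qed
  have "?\<psi> \<in> hom (\<Gamma>\<lparr>carrier := ?K\<rparr>) N"
  proof (rule homI)
    fix x y assume "x \<in> carrier (\<Gamma>\<lparr>carrier := ?K\<rparr>)" "y \<in> carrier (\<Gamma>\<lparr>carrier := ?K\<rparr>)"
    then have x: "x \<in> ?K" and y: "y \<in> ?K" by auto
    have xy: "x \<otimes>\<^bsub>\<Gamma>\<^esub> y \<in> ?K"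
      using x y K by (simp add: subgroup.m_closed)
    have "i (?\<psi> (x \<otimes>\<^bsub>\<Gamma>\<^esub> y)) = i (?\<psi> x \<otimes>\<^bsub>N\<^esub> ?\<psi> y)"
      using x y lift xy hom_mult[OF i_hom] by (simp add: kernel_def del: o_apply)
    then have "?\<psi> (x \<otimes>\<^bsub>\<Gamma>\<^esub> y) = ?\<psi> x \<otimes>\<^bsub>N\<^esub> ?\<psi> y"
    proof (rule inj_onD[OF inj])
      show "?\<psi> x \<otimes>\<^bsub>N\<^esub> ?\<psi> y \<in> carrier N"
        using lift(1)[OF x] lift(1)[OF y] \<open>group N\<close>
        by (intro monoid.m_closed group.is_monoid)
    qed (rule lift(1)[OF xy])
    then show "?\<psi> (x \<otimes>\<^bsub>\<Gamma>\<lparr>carrier := ?K\<rparr>\<^esub> y) = ?\<psi> x \<otimes>\<^bsub>N\<^esub> ?\<psi> y" by simp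
  qed (use lift in auto)
  with K index have "finite (?\<psi> ` ?K)" by (rule N)
  then have "finite (i ` ?\<psi> ` ?K)" by simp
  also have "i ` ?\<psi> ` ?K = \<phi> ` ?K"
    unfolding image_image using lift(2) by (rule image_cong[OF refl])
  finally show ?thesis
    using K index by (intro \<phi>.finite_image_if_finite_index)
qed

text \<open>
  The hypothesis is needed: if \<open>R\<close> is not contained in the carrier, the intersection defining its
  normal closure is over the empty family, and is all of \<open>UNIV\<close>.
\<close>

lemma (in group) normal_normal_closure:
  assumes "R \<subseteq> carrier G"
  shows "normal_closure G R \<lhd> G"
  unfolding normal_closure_def
proof (rule normal_invI)
  show "subgroup (\<Inter> {N. N \<lhd> G \<and> R \<subseteq> N}) G"
  proof (rule subgroups_Inter)
    have "carrier G \<lhd> G"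
      by (intro normal_invI subgroup_self) auto
    with assms show "{N. N \<lhd> G \<and> R \<subseteq> N} \<noteq> {}" by blast
  qed (auto intro: normal_imp_subgroup)
qed (auto intro: normal.inv_op_closed2)

lemma (in group) list_mult_closed:
  "set xs \<subseteq> carrier G \<Longrightarrow> list_mult G xs \<in> carrier G"
  by (induction xs) (auto simp: list_mult_def)

lemma gens_pow_subset_carrier: "gens_pow k j \<subseteq> carrier (free_group k)"
proof -
  have "free_gens k \<subseteq> carrier (free_group k)"
    by (auto simp: free_gens_def free_group_def)
  then show ?thesis
    using group.list_mult_closed[OF group_free_group] unfolding gens_pow_def by blast
qed

lemma group_monster_group:
  assumes "\<alpha> \<in> space (labelling_measure k j \<Omega> arev)"
  shows "group (monster_group k \<Omega> \<alpha>)"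
proof -
  interpret F: group "free_group k" by (rule group_free_group)
  have \<alpha>: "\<alpha> n e \<in> carrier (free_group k)" if "e \<in> arcs (\<Omega> n)" for n e
    using assms that gens_pow_subset_carrier[of k j]
    by (auto simp: labelling_measure_def space_PiM space_uniform_count_measure labellings_def
        PiE_iff)
  have "monster_relators k \<Omega> \<alpha> \<subseteq> carrier (free_group k)"
  proof
    fix w assume "w \<in> monster_relators k \<Omega> \<alpha>"
    then obtain n u p where w: "w = list_mult (free_group k) (map (\<alpha> n) p)"
      and "pre_digraph.awalk (\<Omega> n) u p u"
      by (auto simp: monster_relators_def)
    then have "set p \<subseteq> arcs (\<Omega> n)"
      by (simp add: pre_digraph.awalk_def)
    with \<alpha> show "w \<in> carrier (free_group k)"
      unfolding w by (intro F.list_mult_closed) auto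
  qed
  then show ?thesis
    unfolding monster_group_def
    by (intro normal.factorgroup_is_group F.normal_normal_closure)
qed

theorem theorem2p53:
  fixes d k j :: nat
    and \<Omega> :: "nat \<Rightarrow> ('v, 'e) pre_digraph"
    and arev :: "nat \<Rightarrow> 'e \<Rightarrow> 'e"
    and N :: "'n monoid" and G :: "'g monoid" and Q :: "'q monoid"
    and i :: "'n \<Rightarrow> 'g" and q :: "'g \<Rightarrow> 'q"
  assumes "d \<ge> 3" and "k \<ge> 2" and "j \<ge> 1"
    and "\<And>n. finite_connected_graph (\<Omega> n) (arev n)"
    and "\<And>n. regular d (\<Omega> n)"
    and "expander \<Omega>"
    and "dg_bounded \<Omega> arev"
    and "large_girth \<Omega> arev"
    and "group N" and "countable (carrier N)"
    and "group G" and "countable (carrier G)"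
    and "group Q" and "countable (carrier Q)"
    and "i \<in> mon N G" and "q \<in> epi G Q" and "kernel G Q q = i ` carrier N"
    and "hereditarily_super_rigid (labelling_measure k j \<Omega> arev) (monster_group k \<Omega>) N"
    and "super_rigid (labelling_measure k j \<Omega> arev) (monster_group k \<Omega>) Q"
  shows "super_rigid (labelling_measure k j \<Omega> arev) (monster_group k \<Omega>) G"
proof -
  let ?M = "labelling_measure k j \<Omega> arev"
  let ?\<Gamma> = "monster_group k \<Omega>"
  have q: "q \<in> hom G Q"
    using \<open>q \<in> epi G Q\<close> by (auto simp: epi_def)
  have "AE \<alpha> in ?M. \<forall>K. subgroup K (?\<Gamma> \<alpha>) \<and> finite (rcosets\<^bsub>?\<Gamma> \<alpha>\<^esub> K) \<longrightarrow>
      (\<forall>\<phi> \<in> hom ((?\<Gamma> \<alpha>)\<lparr>carrier := K\<rparr>) N. finite (\<phi> ` K))"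
    using \<open>hereditarily_super_rigid ?M ?\<Gamma> N\<close> by (simp only: hereditarily_super_rigid_def)
  moreover have "AE \<alpha> in ?M. \<forall>\<phi> \<in> hom (?\<Gamma> \<alpha>) Q. finite (\<phi> ` carrier (?\<Gamma> \<alpha>))"
    using \<open>super_rigid ?M ?\<Gamma> Q\<close> by (simp only: super_rigid_def)
  ultimately have "AE \<alpha> in ?M. \<forall>\<phi> \<in> hom (?\<Gamma> \<alpha>) G. finite (\<phi> ` carrier (?\<Gamma> \<alpha>))"
    using AE_space
  proof eventually_elim
    case (elim \<alpha>)
    then show ?case
      using finite_image_of_extension[OF group_monster_group[OF elim(3)] \<open>group N\<close> \<open>group G\<close>
          \<open>group Q\<close> \<open>i \<in> mon N G\<close> q \<open>kernel G Q q = i ` carrier N\<close>] by blast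
  qed
  then show ?thesis by (simp only: super_rigid_def)
qed

end
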